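(* Let $\mathfrak g$ be a $5$-dimensional non-unimodular real Lie algebra and let $\beta\in\mathfrak g^*$ be the form corresponding to the linear map $\mathfrak g\to\mathbb R$, $X\mapsto\operatorname{tr}\operatorname{ad}X$. If $\mathfrak g$ has a hypo structure $(\alpha,\omega_1,\omega_2,\omega_3)$, then $\alpha$ and $\beta$ are orthogonal with respect to the underlying metric.
   Context: A Lie algebra is unimodular if $\operatorname{tr}\operatorname{ad}X=0$ for all $X$. For a Lie algebra $\mathfrak g$, $d$ denotes the Chevalley--Eilenberg differential on $\Lambda^*\mathfrak g^*$. A hypo structure on a $5$-dimensional Lie algebra $\mathfrak g$ is a quadruplet $(\alpha,\omega_1,\omega_2,\omega_3)$, with $\alpha\in\mathfrak g^*$ and $\omega_i\in\Lambda^2\mathfrak g^*$, for which there is a basis $f^1,\dots,f^5$ of $\mathfrak g^*$ (an adapted coframe) such that $$\alpha=f^5,\quad \omega_1=f^{12}+f^{34},\quad \omega_2=f^{13}+f^{42},\quad \omega_3=f^{14}+f^{23}\qquad (f^{ij}=f^i\wedge f^j),$$ and such that $d\omega_1=0$, $d(\omega_2\wedge\alpha)=0$ and $d(\omega_3\wedge\alpha)=0$. The underlying metric is the inner product on $\mathfrak g^*$ (equivalently on $\mathfrak g$) for which an adapted coframe is orthonormal; it does not depend on the choice of adapted coframe. *)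

theory Defs
  imports "HOL-Analysis.Analysis"
begin

definition real_lie_algebra :: "('g::real_vector \<Rightarrow> 'g \<Rightarrow> 'g) \<Rightarrow> bool" where
  "real_lie_algebra br \<longleftrightarrow>
     bilinear br \<and> (\<forall>x. br x x = 0) \<and>
     (\<forall>x y z. br x (br y z) + br y (br z x) + br z (br x y) = 0)"

text \<open>
  The trace of an endomorphism of a finite-dimensional space; by lemma \<open>lin_trace_eq\<close> below it can
  be computed in any finite basis.
\<close>

definition lin_trace :: "('g::real_vector \<Rightarrow> 'g) \<Rightarrow> real" where
  "lin_trace T =
     (let B = (SOME B. independent B \<and> span B = UNIV)
      in \<Sum>b\<in>B. representation B (T b) b)"

definition unimodular :: "('g::real_vector \<Rightarrow> 'g \<Rightarrow> 'g) \<Rightarrow> bool" where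
  "unimodular br \<longleftrightarrow> (\<forall>X. lin_trace (br X) = 0)"

definition trace_form :: "('g::real_vector \<Rightarrow> 'g \<Rightarrow> 'g) \<Rightarrow> 'g \<Rightarrow> real" where
  "trace_form br = (\<lambda>X. lin_trace (br X))"

text \<open>
  An element of the exterior algebra of the dual space is represented by a function on lists of
  vectors, whose restriction to lists of length \<open>k\<close> is its component of degree \<open>k\<close>, an alternating
  \<open>k\<close>-linear form. In particular a homogeneous \<open>k\<close>-form vanishes on lists of any other length.
\<close>

type_synonym 'g form = "'g list \<Rightarrow> real"

definition one_form :: "('g \<Rightarrow> real) \<Rightarrow> 'g form" where
  "one_form a xs = (case xs of [x] \<Rightarrow> a x | _ \<Rightarrow> 0)"

text \<open>
  The wedge product is the sum over shuffles, without a normalising factor, so that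
  \<open>(a \<and> b)(x, y) = a x * b y - a y * b x\<close> for one-forms. A shuffle is given by the set \<open>S\<close> of the
  positions of those arguments that go into the first factor; its sign counts the inversions.
\<close>

definition wedge :: "'g form \<Rightarrow> 'g form \<Rightarrow> 'g form" where
  "wedge u v xs =
     (\<Sum>S\<in>Pow {..<length xs}.
        (-1) ^ card {(i, j). i \<in> S \<and> j \<in> {..<length xs} - S \<and> j < i}
        * u (nths xs S) * v (nths xs (- S)))"

text \<open>
  The Chevalley--Eilenberg differential
  \<open>du(x\<^sub>0,\<dots>,x\<^sub>k) = (\<Sum>i<j. (-1)^(i+j) u([x\<^sub>i,x\<^sub>j], x\<^sub>0,\<dots>,x\<^sub>k without x\<^sub>i and x\<^sub>j))\<close>.
\<close>

definition ce_diff :: "('g \<Rightarrow> 'g \<Rightarrow> 'g) \<Rightarrow> 'g form \<Rightarrow> 'g form" where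
  "ce_diff br u xs =
     (\<Sum>j<length xs. \<Sum>i<j. (-1) ^ (i + j) * u (br (xs ! i) (xs ! j) # nths xs (- {i, j})))"

definition coframe :: "(nat \<Rightarrow> 'g::real_vector \<Rightarrow> real) \<Rightarrow> bool" where
  "coframe f \<longleftrightarrow>
     (\<forall>i\<in>{1..5}. linear (f i)) \<and>
     (\<forall>c. (\<forall>x. (\<Sum>i=1..5. c i * f i x) = 0) \<longrightarrow> (\<forall>i\<in>{1..5}. c i = 0)) \<and>
     (\<forall>\<phi>. linear \<phi> \<longrightarrow> (\<exists>c. \<forall>x. \<phi> x = (\<Sum>i=1..5. c i * f i x)))"

definition adapted_coframe ::
  "(nat \<Rightarrow> 'g::real_vector \<Rightarrow> real) \<Rightarrow> ('g \<Rightarrow> real) \<Rightarrow> 'g form \<Rightarrow> 'g form \<Rightarrow> 'g form \<Rightarrow> bool" where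
  "adapted_coframe f \<alpha> \<omega>\<^sub>1 \<omega>\<^sub>2 \<omega>\<^sub>3 \<longleftrightarrow>
     (let e = (\<lambda>i j. wedge (one_form (f i)) (one_form (f j)))
      in coframe f \<and> \<alpha> = f 5 \<and>
         \<omega>\<^sub>1 = (\<lambda>xs. e 1 2 xs + e 3 4 xs) \<and>
         \<omega>\<^sub>2 = (\<lambda>xs. e 1 3 xs + e 4 2 xs) \<and>
         \<omega>\<^sub>3 = (\<lambda>xs. e 1 4 xs + e 2 3 xs))"

definition hypo_structure ::
  "('g::real_vector \<Rightarrow> 'g \<Rightarrow> 'g) \<Rightarrow> ('g \<Rightarrow> real) \<Rightarrow> 'g form \<Rightarrow> 'g form \<Rightarrow> 'g form \<Rightarrow> bool" where
  "hypo_structure br \<alpha> \<omega>\<^sub>1 \<omega>\<^sub>2 \<omega>\<^sub>3 \<longleftrightarrow>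
     (\<exists>f. adapted_coframe f \<alpha> \<omega>\<^sub>1 \<omega>\<^sub>2 \<omega>\<^sub>3) \<and>
     ce_diff br \<omega>\<^sub>1 = (\<lambda>_. 0) \<and>
     ce_diff br (wedge \<omega>\<^sub>2 (one_form \<alpha>)) = (\<lambda>_. 0) \<and>
     ce_diff br (wedge \<omega>\<^sub>3 (one_form \<alpha>)) = (\<lambda>_. 0)"

text \<open>The inner product on the dual space for which the coframe \<open>f\<close> is orthonormal.\<close>

definition coframe_inner ::
  "(nat \<Rightarrow> 'g::real_vector \<Rightarrow> real) \<Rightarrow> ('g \<Rightarrow> real) \<Rightarrow> ('g \<Rightarrow> real) \<Rightarrow> real" where
  "coframe_inner f \<phi> \<psi> =
     (THE r. \<exists>a b. \<phi> = (\<lambda>x. \<Sum>i=1..5. a i * f i x) \<and> \<psi> = (\<lambda>x. \<Sum>i=1..5. b i * f i x) \<and>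
                   r = (\<Sum>i=1..5. a i * b i))"

text \<open>Lemma \<open>underlying_metric_eq\<close> below shows that the choice of adapted coframe is immaterial.\<close>

definition underlying_metric ::
  "('g::real_vector \<Rightarrow> real) \<Rightarrow> 'g form \<Rightarrow> 'g form \<Rightarrow> 'g form \<Rightarrow> ('g \<Rightarrow> real) \<Rightarrow> ('g \<Rightarrow> real) \<Rightarrow> real" where
  "underlying_metric \<alpha> \<omega>\<^sub>1 \<omega>\<^sub>2 \<omega>\<^sub>3 =
     coframe_inner (SOME f. adapted_coframe f \<alpha> \<omega>\<^sub>1 \<omega>\<^sub>2 \<omega>\<^sub>3)"

lemma lin_trace_eq:
  fixes T :: "'g::real_vector \<Rightarrow> 'g"
  assumes T: "linear T" and C: "independent C" "span C = UNIV" "finite C"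
  shows "lin_trace T = (\<Sum>c\<in>C. representation C (T c) c)"
proof -
  define B where "B = (SOME B::'g set. independent B \<and> span B = UNIV)"
  have B: "independent B" "span B = UNIV"
    using someI[of "\<lambda>B::'g set. independent B \<and> span B = UNIV" C] C unfolding B_def by auto
  have finB: "finite B"
    using real_vector.independent_span_bound[of C B] C B by auto
  have lr: "linear (\<lambda>v. representation D v d)"
    if "independent D" "span D = UNIV" for D :: "'g set" and d
    using that real_vector.linear_representation[of D d]
    by (auto simp: linear_iff real_vector.representation_add real_vector.representation_scale)
  have "lin_trace T = (\<Sum>b\<in>B. representation B (T b) b)"
    by (simp add: lin_trace_def B_def Let_def)
  also have "\<dots> = (\<Sum>b\<in>B. \<Sum>c\<in>C. representation C b c * representation B (T c) b)"
  proof (rule sum.cong[OF refl])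
    fix b assume "b \<in> B"
    have "b = (\<Sum>c\<in>C. representation C b c *\<^sub>R c)"
      using real_vector.sum_representation_eq[of C b C] C by simp
    then have "representation B (T b) b
        = representation B (T (\<Sum>c\<in>C. representation C b c *\<^sub>R c)) b" by metis
    also have "\<dots> = (\<Sum>c\<in>C. representation C b c * representation B (T c) b)"
      using lr[OF B, of b]
      by (simp add: linear_sum[OF T] linear_sum[OF lr[OF B, of b]] linear_cmul[OF T]
          linear_cmul[OF lr[OF B, of b]])
    finally show "representation B (T b) b = \<dots>" .
  qed
  also have "\<dots> = (\<Sum>c\<in>C. \<Sum>b\<in>B. representation B (T c) b * representation C b c)"
    by (subst sum.swap) (simp add: mult.commute)
  also have "\<dots> = (\<Sum>c\<in>C. representation C (T c) c)"
  proof (rule sum.cong[OF refl])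
    fix c assume "c \<in> C"
    have "T c = (\<Sum>b\<in>B. representation B (T c) b *\<^sub>R b)"
      using real_vector.sum_representation_eq[of B "T c" B] B finB by simp
    then have "representation C (T c) c
        = representation C (\<Sum>b\<in>B. representation B (T c) b *\<^sub>R b) c" by metis
    also have "\<dots> = (\<Sum>b\<in>B. representation B (T c) b * representation C b c)"
      by (simp add: linear_sum[OF lr[OF C(1,2), of c]] linear_cmul[OF lr[OF C(1,2), of c]])
    finally show "(\<Sum>b\<in>B. representation B (T c) b * representation C b c)
        = representation C (T c) c" by simp
  qed
  finally show ?thesis .
qed

lemma wedge_one_form_two:
  "wedge (one_form a) (one_form b) [x, y] = a x * b y - a y * b x"
proof -
  have P: "Pow {..<length [x, y]} = {{}, {0}, {Suc 0}, {0, Suc 0}}"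
    by (auto simp: lessThan_Suc Pow_insert numeral_2_eq_2)
  have c: "{(i::nat, j::nat). i = 0 \<and> j < Suc (Suc 0) \<and> 0 < j \<and> j < i} = {}"
    "{(i::nat, j::nat). i = Suc 0 \<and> j < Suc (Suc 0) \<and> j \<noteq> Suc 0 \<and> j < i} = {(Suc 0, 0)}"
    by auto
  have d: "{} \<noteq> {0::nat}" "{} \<noteq> {Suc 0}" "{} \<noteq> {0, Suc 0}" "{0::nat} \<noteq> {Suc 0}"
    "{0::nat} \<noteq> {0, Suc 0}" "{Suc 0} \<noteq> {0, Suc 0}" by auto
  show ?thesis
    unfolding wedge_def P using d
    by (simp add: c nths_Cons one_form_def)
qed

lemma coframe_dual_frame:
  fixes f :: "nat \<Rightarrow> 'g::real_vector \<Rightarrow> real"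
  assumes f: "coframe f" and dim: "dim (UNIV :: 'g set) = 5"
  shows "\<exists>e. (\<forall>i\<in>{1..5}. \<forall>j\<in>{1..5}. f i (e j) = (if i = j then 1 else 0)) \<and>
      (\<forall>x. x = (\<Sum>i=1..5. f i x *\<^sub>R e i))"
proof -
  obtain h :: "5 \<Rightarrow> nat" where h: "bij_betw h UNIV {1..5}"
    using ex_bij_betw_nat_finite finite_same_card_bij[of "UNIV :: 5 set" "{1..5::nat}"] by auto
  define F where "F x = (\<chi> i. f (h i) x)" for x
  have hin: "h i \<in> {1..5}" for i using h by (auto simp: bij_betw_def)
  have hsur: "\<exists>k. h k = i" if "i \<in> {1..5}" for i
    using that unfolding bij_betw_imp_surj_on[OF h, symmetric] by auto
  have lin: "linear (f i)" if "i \<in> {1..5}" for i using f that by (simp add: coframe_def)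
  have linF: "linear F"
    using lin[OF hin] unfolding linear_iff F_def by (simp add: vec_eq_iff)
  obtain B :: "'g set" where B': "B \<subseteq> UNIV" "independent B" "UNIV \<subseteq> span B" "card B = dim (UNIV :: 'g set)"
    by (rule real_vector.basis_exists)
  then have B: "independent B" "span B = UNIV" "card B = 5" using dim by auto
  have finB: "finite B" by (rule card_ge_0_finite) (simp add: B(3))
  have F0: "x = 0" if Fx: "F x = 0" for x
  proof -
    have z: "f i x = 0" if i: "i \<in> {1..5}" for i
    proof -
      obtain k where "h k = i" using hsur[OF i] by blast
      moreover have "F x $ k = 0" by (simp add: Fx)
      ultimately show ?thesis by (simp add: F_def)
    qed
    have "representation B x b = 0" for b
    proof -
      have "linear (\<lambda>v. representation B v b)"
        using B by (auto simp: linear_iff real_vector.representation_add real_vector.representation_scale)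
      then obtain c where "\<And>x. representation B x b = (\<Sum>i=1..5. c i * f i x)"
        using f unfolding coframe_def by blast
      then have "representation B x b = (\<Sum>i=1..5. c i * f i x)" .
      also have "\<dots> = 0" by (rule sum.neutral) (simp add: z)
      finally show ?thesis .
    qed
    then show "x = 0"
      using real_vector.sum_representation_eq[of B x B] B finB by simp
  qed
  have inj: "inj F"
  proof (rule injI)
    fix x y assume "F x = F y"
    then have "F (x - y) = 0" by (simp add: linear_diff[OF linF])
    then show "x = y" using F0 by fastforce
  qed
  have "independent (F ` B)"
    using real_vector.linear_independent_injective_image linF B(1) inj
    by (metis inj_on_subset linear_independent_injective_image subset_UNIV)
  moreover have "card (F ` B) = 5" using B(3) inj by (metis card_image inj_on_subset subset_UNIV)
  ultimately have "span (F ` B) = UNIV"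
    using card_ge_dim_independent[of "F ` B" UNIV] by (auto simp: dim_UNIV)
  then have sur: "surj F"
    using linear_span_image[OF linF, of B] B(2) by simp
  define e where "e j = inv F (\<chi> i. if h i = j then 1 else 0)" for j
  have Fe: "F (e j) = (\<chi> i. if h i = j then 1 else 0)" for j
    unfolding e_def by (rule surj_f_inv_f[OF sur])
  have fe: "f i (e j) = (if i = j then 1 else 0)" if i: "i \<in> {1..5}" for i j
  proof -
    obtain k where k: "h k = i" using hsur[OF i] by blast
    show ?thesis using Fe[of j] k by (auto simp: F_def vec_eq_iff)
  qed
  have ex: "x = (\<Sum>i=1..5. f i x *\<^sub>R e i)" for x
  proof (rule injD[OF inj])
    have "f k (\<Sum>i=1..5. f i x *\<^sub>R e i) = f k x" if "k \<in> {1..5}" for k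
      using that
      by (simp add: linear_sum[OF lin[OF that]] linear_cmul[OF lin[OF that]] fe if_distrib cong: if_cong)
    then show "F x = F (\<Sum>i=1..5. f i x *\<^sub>R e i)"
      using hin by (simp add: F_def vec_eq_iff)
  qed
  show ?thesis
    by (intro exI[of _ e] conjI ballI allI) (rule fe, assumption, rule ex)
qed

lemma coframe_inner_eq:
  fixes f :: "nat \<Rightarrow> 'g::real_vector \<Rightarrow> real"
  assumes f: "coframe f"
    and e: "\<And>i j. i \<in> {1..5} \<Longrightarrow> j \<in> {1..5} \<Longrightarrow> f i (e j) = (if i = j then 1 else 0)"
    and lin: "linear \<phi>" "linear \<psi>"
  shows "coframe_inner f \<phi> \<psi> = (\<Sum>i=1..5. \<phi> (e i) * \<psi> (e i))"
proof -
  have c: "a j = \<theta> (e j)" if "\<theta> = (\<lambda>x. \<Sum>i=1..5. a i * f i x)" "j \<in> {1..5}" for a \<theta> j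
  proof -
    have "\<theta> (e j) = (\<Sum>i=1..5. a i * (if i = j then 1 else 0))"
      unfolding that(1) by (rule sum.cong[OF refl]) (simp only: e that(2))
    also have "\<dots> = a j" using that(2) by (simp add: if_distrib cong: if_cong)
    finally show ?thesis ..
  qed
  obtain a where a: "\<phi> = (\<lambda>x. \<Sum>i=1..5. a i * f i x)"
    using f lin(1) unfolding coframe_def by blast
  obtain b where b: "\<psi> = (\<lambda>x. \<Sum>i=1..5. b i * f i x)"
    using f lin(2) unfolding coframe_def by blast
  have val: "(\<Sum>i=1..5. a' i * b' i) = (\<Sum>i=1..5. \<phi> (e i) * \<psi> (e i))"
    if "\<phi> = (\<lambda>x. \<Sum>i=1..5. a' i * f i x)" "\<psi> = (\<lambda>x. \<Sum>i=1..5. b' i * f i x)" for a' b'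
    using c[OF that(1)] c[OF that(2)] by (intro sum.cong) simp_all
  show ?thesis
    unfolding coframe_inner_def
  proof (rule the_equality)
    show "\<exists>a b. \<phi> = (\<lambda>x. \<Sum>i=1..5. a i * f i x) \<and> \<psi> = (\<lambda>x. \<Sum>i=1..5. b i * f i x) \<and>
        (\<Sum>i=1..5. \<phi> (e i) * \<psi> (e i)) = (\<Sum>i=1..5. a i * b i)"
      using a b val[OF a b] by metis
  qed (use val in blast)
qed

lemma sum_1_5: "(\<Sum>i=1..5. g i) = g 1 + g 2 + g 3 + g 4 + (g (5::nat) :: 'a::comm_monoid_add)"
  by (simp add: numeral_eq_Suc atLeastAtMostSuc_conv add_ac)

lemma adapted_coframe_norm:
  fixes f :: "nat \<Rightarrow> 'g::real_vector \<Rightarrow> real"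
  assumes f: "adapted_coframe f \<alpha> \<omega>\<^sub>1 \<omega>\<^sub>2 \<omega>\<^sub>3" and dim: "dim (UNIV :: 'g set) = 5"
  shows "\<exists>y. \<forall>z. \<omega>\<^sub>2 [x, z] = \<omega>\<^sub>3 [y, z]"
    and "(\<forall>z. \<omega>\<^sub>2 [x, z] = \<omega>\<^sub>3 [y, z]) \<Longrightarrow> (\<Sum>i=1..5. (f i x)\<^sup>2) = \<omega>\<^sub>1 [x, y] + (\<alpha> x)\<^sup>2"
proof -
  have cf: "coframe f" and \<alpha>: "\<alpha> = f 5" using f by (auto simp: adapted_coframe_def Let_def)
  have lin: "linear (f i)" if "i \<in> {1..5}" for i using cf that by (simp add: coframe_def)
  have w1: "\<omega>\<^sub>1 [x, y] = f 1 x * f 2 y - f 1 y * f 2 x + (f 3 x * f 4 y - f 3 y * f 4 x)"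
    and w2: "\<omega>\<^sub>2 [x, y] = f 1 x * f 3 y - f 1 y * f 3 x + (f 4 x * f 2 y - f 4 y * f 2 x)"
    and w3: "\<omega>\<^sub>3 [x, y] = f 1 x * f 4 y - f 1 y * f 4 x + (f 2 x * f 3 y - f 2 y * f 3 x)" for x y
    using f by (auto simp: adapted_coframe_def Let_def wedge_one_form_two)
  obtain e where e: "\<forall>i\<in>{1..5}. \<forall>j\<in>{1..5}. f i (e j) = (if i = j then 1 else 0)"
    and exe: "\<forall>x. x = (\<Sum>i=1..5. f i x *\<^sub>R e i)"
    using coframe_dual_frame[OF cf dim] by blast
  have e: "f i (e j) = (if i = j then 1 else 0)" if "i \<in> {1..5}" "j \<in> {1..5}" for i j
    using e that by blast
  define y0 where "y0 = (- f 2 x) *\<^sub>R e 1 + f 1 x *\<^sub>R e 2 + (- f 4 x) *\<^sub>R e 3 + f 3 x *\<^sub>R e 4"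
  have y0: "f i y0 = (- f 2 x) * f i (e 1) + f 1 x * f i (e 2) + (- f 4 x) * f i (e 3)
      + f 3 x * f i (e 4)" if "i \<in> {1..5}" for i
    unfolding y0_def using lin[OF that] by (simp add: linear_add linear_diff linear_cmul)
  have "f 1 y0 = - f 2 x" "f 2 y0 = f 1 x" "f 3 y0 = - f 4 x" "f 4 y0 = f 3 x"
    by (simp_all add: y0 e)
  then show "\<exists>y. \<forall>z. \<omega>\<^sub>2 [x, z] = \<omega>\<^sub>3 [y, z]"
    by (intro exI[of _ y0]) (simp add: w2 w3 algebra_simps)
  assume eq: "\<forall>z. \<omega>\<^sub>2 [x, z] = \<omega>\<^sub>3 [y, z]"
  have "f 1 y = - f 2 x" "f 2 y = f 1 x" "f 3 y = - f 4 x" "f 4 y = f 3 x"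
    using eq[rule_format, of "e 4"] eq[rule_format, of "e 3"] eq[rule_format, of "e 2"]
      eq[rule_format, of "e 1"] by (simp_all add: w2 w3 e)
  then show "(\<Sum>i=1..5. (f i x)\<^sup>2) = \<omega>\<^sub>1 [x, y] + (\<alpha> x)\<^sup>2"
    unfolding sum_1_5 by (simp add: w1 \<alpha> power2_eq_square)
qed

lemma adapted_coframe_inner_unique:
  fixes f g :: "nat \<Rightarrow> 'g::real_vector \<Rightarrow> real"
  assumes f: "adapted_coframe f \<alpha> \<omega>\<^sub>1 \<omega>\<^sub>2 \<omega>\<^sub>3" and g: "adapted_coframe g \<alpha> \<omega>\<^sub>1 \<omega>\<^sub>2 \<omega>\<^sub>3"
    and dim: "dim (UNIV :: 'g set) = 5" and lin: "linear \<phi>" "linear \<psi>"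
  shows "coframe_inner f \<phi> \<psi> = coframe_inner g \<phi> \<psi>"
proof -
  have cf: "coframe f" and cg: "coframe g"
    using f g by (auto simp: adapted_coframe_def Let_def)
  have sq: "(\<Sum>i=1..5. (f i x)\<^sup>2) = (\<Sum>i=1..5. (g i x)\<^sup>2)" for x
    using adapted_coframe_norm[OF f dim] adapted_coframe_norm(2)[OF g dim] by metis
  have pol: "(\<Sum>i=1..5. k i x * k i y)
      = ((\<Sum>i=1..5. (k i (x + y))\<^sup>2) - (\<Sum>i=1..5. (k i x)\<^sup>2) - (\<Sum>i=1..5. (k i y)\<^sup>2)) / 2"
    if "coframe k" for k :: "nat \<Rightarrow> 'g \<Rightarrow> real" and x y
  proof -
    have l: "k i (x + y) = k i x + k i y" if "i \<in> {1..5}" for i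
      using \<open>coframe k\<close> that by (simp add: coframe_def linear_iff)
    then show ?thesis
      unfolding sum_1_5 by (simp add: power2_eq_square algebra_simps)
  qed
  have bil: "(\<Sum>i=1..5. f i x * f i y) = (\<Sum>i=1..5. g i x * g i y)" for x y
    unfolding pol[OF cf] pol[OF cg] sq ..
  obtain e where e: "\<forall>i\<in>{1..5}. \<forall>j\<in>{1..5}. f i (e j) = (if i = j then 1 else 0)"
    and exe: "\<forall>x. x = (\<Sum>i=1..5. f i x *\<^sub>R e i)"
    using coframe_dual_frame[OF cf dim] by blast
  have e: "f i (e j) = (if i = j then 1 else 0)" if "i \<in> {1..5}" "j \<in> {1..5}" for i j
    using e that by blast
  obtain e' where e': "\<forall>i\<in>{1..5}. \<forall>j\<in>{1..5}. g i (e' j) = (if i = j then 1 else 0)"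
    and exe': "\<forall>x. x = (\<Sum>i=1..5. g i x *\<^sub>R e' i)"
    using coframe_dual_frame[OF cg dim] by blast
  have e': "g i (e' j) = (if i = j then 1 else 0)" if "i \<in> {1..5}" "j \<in> {1..5}" for i j
    using e' that by blast
  have fg: "g j (e i) = f i (e' j)" if "i \<in> {1..5}" "j \<in> {1..5}" for i j
    using bil[of "e i" "e' j"] that by (simp add: e e' if_distrib[of "\<lambda>x. x * _"]
        if_distrib[of "\<lambda>x. _ * x"] cong: if_cong)
  have exp: "\<theta> (e i) = (\<Sum>j=1..5. f i (e' j) * \<theta> (e' j))"
    if "linear \<theta>" "i \<in> {1..5}" for \<theta> :: "'g \<Rightarrow> real" and i
  proof -
    have "\<theta> (e i) = \<theta> (\<Sum>j=1..5. g j (e i) *\<^sub>R e' j)" using exe' by metis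
    also have "\<dots> = (\<Sum>j=1..5. f i (e' j) * \<theta> (e' j))"
      using that fg by (simp add: linear_sum[OF that(1)] linear_cmul[OF that(1)])
    finally show ?thesis .
  qed
  have orth: "(\<Sum>i=1..5. f i (e' j) * f i (e' k)) = (if j = k then 1 else 0)"
    if "j \<in> {1..5}" "k \<in> {1..5}" for j k
  proof -
    have "(\<Sum>i=1..5. f i (e' j) * f i (e' k))
        = (\<Sum>i=1..5. (if i = j then 1 else 0) * (if i = k then 1 else 0))"
      unfolding bil by (rule sum.cong[OF refl]) (simp only: e' that)
    also have "\<dots> = (if j = k then 1 else 0)"
      using that by (simp add: if_distrib[of "\<lambda>x. x * _"] cong: if_cong)
    finally show ?thesis .
  qed
  have "coframe_inner f \<phi> \<psi> = (\<Sum>i=1..5. \<phi> (e i) * \<psi> (e i))"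
    by (rule coframe_inner_eq[OF cf e lin])
  also have "\<dots> = (\<Sum>i=1..5. \<Sum>j=1..5. \<Sum>k=1..5.
      (f i (e' j) * f i (e' k)) * (\<phi> (e' j) * \<psi> (e' k)))"
    by (intro sum.cong refl) (simp add: exp lin sum_product mult_ac)
  also have "\<dots> = (\<Sum>j=1..5. \<Sum>k=1..5. (\<Sum>i=1..5. f i (e' j) * f i (e' k)) * (\<phi> (e' j) * \<psi> (e' k)))"
    by (subst sum.swap, rule sum.cong[OF refl], subst sum.swap) (simp add: sum_distrib_right)
  also have "\<dots> = (\<Sum>j=1..5. \<phi> (e' j) * \<psi> (e' j))"
  proof (rule sum.cong[OF refl])
    fix j :: nat assume j: "j \<in> {1..5}"
    have "(\<Sum>k=1..5. (\<Sum>i=1..5. f i (e' j) * f i (e' k)) * (\<phi> (e' j) * \<psi> (e' k)))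
        = (\<Sum>k=1..5. (if j = k then 1 else 0) * (\<phi> (e' j) * \<psi> (e' k)))"
      by (rule sum.cong[OF refl]) (simp only: orth j)
    also have "\<dots> = \<phi> (e' j) * \<psi> (e' j)"
      using j by (simp add: if_distrib[of "\<lambda>x. x * _"] cong: if_cong)
    finally show "(\<Sum>k=1..5. (\<Sum>i=1..5. f i (e' j) * f i (e' k)) * (\<phi> (e' j) * \<psi> (e' k)))
        = \<phi> (e' j) * \<psi> (e' j)" .
  qed
  also have "\<dots> = coframe_inner g \<phi> \<psi>"
    by (rule coframe_inner_eq[OF cg e' lin, symmetric])
  finally show ?thesis .
qed

lemma underlying_metric_eq:
  fixes f :: "nat \<Rightarrow> 'g::real_vector \<Rightarrow> real"
  assumes "adapted_coframe f \<alpha> \<omega>\<^sub>1 \<omega>\<^sub>2 \<omega>\<^sub>3" and "dim (UNIV :: 'g set) = 5"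
    and "linear \<phi>" "linear \<psi>"
  shows "underlying_metric \<alpha> \<omega>\<^sub>1 \<omega>\<^sub>2 \<omega>\<^sub>3 \<phi> \<psi> = coframe_inner f \<phi> \<psi>"
  unfolding underlying_metric_def
  using someI[of "\<lambda>f. adapted_coframe f \<alpha> \<omega>\<^sub>1 \<omega>\<^sub>2 \<omega>\<^sub>3" f] assms
  by (blast intro: adapted_coframe_inner_unique)

end

theory Submission
  imports Defs
begin

text \<open>
  On a \<open>5\<close>-dimensional Lie algebra the Chevalley--Eilenberg differential of a \<open>4\<close>-form \<open>\<eta>\<close> is
  \<open>\<beta> \<and> \<eta>\<close> up to a universal sign, since contracting a volume form with \<open>X\<close> and then
  differentiating multiplies the volume form by \<open>\<plusminus> tr ad X\<close>. As \<open>\<omega>\<^sub>1\<close> is closed, so is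
  \<open>\<omega>\<^sub>1 \<and> \<omega>\<^sub>1 = 2 f\<^sup>1\<^sup>2\<^sup>3\<^sup>4\<close>; hence \<open>\<beta> \<and> f\<^sup>1\<^sup>2\<^sup>3\<^sup>4 = 0\<close>, that is, \<open>\<beta>\<close> vanishes on
  the vector \<open>e\<^sub>5\<close> of the dual frame. Since the coframe is orthonormal and \<open>\<alpha> = f\<^sup>5\<close>, the number
  \<open>\<beta>(e\<^sub>5)\<close> is the inner product of \<open>\<alpha>\<close> and \<open>\<beta>\<close>.

  The vanishing of \<open>\<beta>(e\<^sub>5)\<close> can be read off \<open>d\<omega>\<^sub>1 = 0\<close> without forming \<open>4\<close>-forms. The form
  \<open>\<omega>\<^sub>1\<close> annihilates \<open>e\<^sub>5\<close>, so \<open>d\<omega>\<^sub>1(e\<^sub>5, y, z) = 0\<close> says that \<open>ad e\<^sub>5\<close> is an infinitesimal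
  symplectic transformation: \<open>\<omega>\<^sub>1([e\<^sub>5, y], z) + \<omega>\<^sub>1(y, [e\<^sub>5, z]) = 0\<close>. On the two symplectic
  planes spanned by \<open>e\<^sub>1, e\<^sub>2\<close> and by \<open>e\<^sub>3, e\<^sub>4\<close> this makes the diagonal entries of \<open>ad e\<^sub>5\<close> cancel
  in pairs, and the last diagonal entry vanishes because \<open>[e\<^sub>5, e\<^sub>5] = 0\<close>.
\<close>

lemma lin_trace_dual_frame:
  fixes T :: "'g::real_vector \<Rightarrow> 'g" and f :: "'i \<Rightarrow> 'g \<Rightarrow> real"
  assumes T: "linear T" and I: "finite I"
    and lin: "\<And>i. i \<in> I \<Longrightarrow> linear (f i)"
    and dual: "\<And>i j. i \<in> I \<Longrightarrow> j \<in> I \<Longrightarrow> f i (e j) = (if i = j then 1 else 0)"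
    and expand: "\<And>x. x = (\<Sum>i\<in>I. f i x *\<^sub>R e i)"
  shows "lin_trace T = (\<Sum>i\<in>I. f i (T (e i)))"
proof -
  have inj: "inj_on e I"
    by (rule inj_onI) (metis dual zero_neq_one)
  have coord: "f i (\<Sum>v\<in>e ` I. u v *\<^sub>R v) = u (e i)" if i: "i \<in> I" for u i
  proof -
    have "f i (\<Sum>v\<in>e ` I. u v *\<^sub>R v) = (\<Sum>j\<in>I. u (e j) * f i (e j))"
      by (simp add: sum.reindex[OF inj] linear_sum[OF lin[OF i]] linear_cmul[OF lin[OF i]])
    also have "\<dots> = (\<Sum>j\<in>I. if i = j then u (e j) else 0)"
      by (rule sum.cong) (auto simp: dual i)
    finally show ?thesis using I i by simp
  qed
  have indep: "independent (e ` I)"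
  proof (rule independent_if_scalars_zero)
    fix u v assume "(\<Sum>v\<in>e ` I. u v *\<^sub>R v) = 0" "v \<in> e ` I"
    then show "u v = 0"
      using coord[of _ u] lin by (metis (no_types, lifting) imageE linear_0)
  qed (simp add: I)
  have "x \<in> span (e ` I)" for x
    by (subst expand) (intro span_sum span_scale span_base imageI)
  then have span: "span (e ` I) = UNIV" by blast
  have "representation (e ` I) x (e i) = f i x" if "i \<in> I" for x i
    using coord[OF that, of "representation (e ` I) x"]
      real_vector.sum_representation_eq[of "e ` I" x "e ` I"] indep span I by simp
  then show ?thesis
    by (simp add: lin_trace_eq[OF T indep span] I sum.reindex[OF inj])
qed

lemma ce_diff_three:
  "ce_diff br u [x, y, z] = - u [br x y, z] + u [br x z, y] - u [br y z, x]"
  by (simp add: ce_diff_def lessThan_Suc nths_Cons numeral_eq_Suc)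

text \<open>
  A closed \<open>2\<close>-form that annihilates \<open>x\<close> is invariant under \<open>ad x\<close>: this is Cartan's formula for
  its Lie derivative along \<open>x\<close>. For an alternating \<open>u\<close> the right-hand side is
  \<open>- u(y, [x, z])\<close>, so that the equation says that \<open>ad x\<close> is skew for \<open>u\<close>.
\<close>

lemma closed_two_form_invariant:
  assumes "ce_diff br u = (\<lambda>_. 0)" and "\<And>w. u [w, x] = 0"
  shows "u [br x y, z] = u [br x z, y]"
  using fun_cong[OF assms(1), of "[x, y, z]"] assms(2)[of "br y z"]
  by (simp add: ce_diff_three)

theorem lemma8:
  fixes br :: "'g::real_vector \<Rightarrow> 'g \<Rightarrow> 'g"
    and \<alpha> :: "'g \<Rightarrow> real"
    and \<omega>\<^sub>1 \<omega>\<^sub>2 \<omega>\<^sub>3 :: "'g form"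
  assumes "real_lie_algebra br"
    and "dim (UNIV :: 'g set) = 5"
    and "\<not> unimodular br"
    and "hypo_structure br \<alpha> \<omega>\<^sub>1 \<omega>\<^sub>2 \<omega>\<^sub>3"
  shows "underlying_metric \<alpha> \<omega>\<^sub>1 \<omega>\<^sub>2 \<omega>\<^sub>3 \<alpha> (trace_form br) = 0"
proof -
  obtain f where f: "adapted_coframe f \<alpha> \<omega>\<^sub>1 \<omega>\<^sub>2 \<omega>\<^sub>3" and closed: "ce_diff br \<omega>\<^sub>1 = (\<lambda>_. 0)"
    using assms(4) by (auto simp: hypo_structure_def)
  have cf: "coframe f" and \<alpha>: "\<alpha> = f 5"
    using f by (auto simp: adapted_coframe_def Let_def)
  have lin: "linear (f i)" if "i \<in> {1..5}" for i
    using cf that by (simp add: coframe_def)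
  have \<omega>\<^sub>1: "\<omega>\<^sub>1 [x, y] = f 1 x * f 2 y - f 1 y * f 2 x + (f 3 x * f 4 y - f 3 y * f 4 x)" for x y
    using f by (auto simp: adapted_coframe_def Let_def wedge_one_form_two)
  obtain e where e: "\<forall>i\<in>{1..5}. \<forall>j\<in>{1..5}. f i (e j) = (if i = j then 1 else 0)"
    and expand: "\<forall>x. x = (\<Sum>i=1..5. f i x *\<^sub>R e i)"
    using coframe_dual_frame[OF cf assms(2)] by blast
  have e: "f i (e j) = (if i = j then 1 else 0)" if "i \<in> {1..5}" "j \<in> {1..5}" for i j
    using e that by blast
  have bil: "bilinear br" and alt: "br x x = 0" for x
    using assms(1) by (auto simp: real_lie_algebra_def)
  have ad: "linear (br X)" and da: "linear (\<lambda>X. br X y)" for X y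
    using bil by (auto simp: bilinear_def)
  have tr: "trace_form br X = (\<Sum>i=1..5. f i (br X (e i)))" for X
    unfolding trace_form_def
    by (rule lin_trace_dual_frame[OF ad _ lin e]) (use expand in auto)
  have lin_tr: "linear (trace_form br)"
    unfolding linear_iff tr
    by (auto simp: linear_add[OF da] linear_cmul[OF da] linear_add[OF lin] linear_cmul[OF lin]
        sum.distrib sum_distrib_left)
  have "\<omega>\<^sub>1 [w, e 5] = 0" for w
    by (simp add: \<omega>\<^sub>1 e)
  then have inv: "\<omega>\<^sub>1 [br (e 5) y, z] = \<omega>\<^sub>1 [br (e 5) z, y]" for y z
    by (rule closed_two_form_invariant[OF closed])
  have "f 1 (br (e 5) (e 1)) + f 2 (br (e 5) (e 2)) = 0"
    using inv[of "e 1" "e 2"] by (simp add: \<omega>\<^sub>1 e)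
  moreover have "f 3 (br (e 5) (e 3)) + f 4 (br (e 5) (e 4)) = 0"
    using inv[of "e 3" "e 4"] by (simp add: \<omega>\<^sub>1 e)
  ultimately have "trace_form br (e 5) = 0"
    unfolding tr sum_1_5 by (simp add: alt linear_0[OF lin])
  moreover have "underlying_metric \<alpha> \<omega>\<^sub>1 \<omega>\<^sub>2 \<omega>\<^sub>3 \<alpha> (trace_form br)
      = (\<Sum>i=1..5. \<alpha> (e i) * trace_form br (e i))"
    using underlying_metric_eq[OF f assms(2) _ lin_tr] coframe_inner_eq[OF cf e _ lin_tr] lin
    by (simp add: \<alpha>)
  ultimately show ?thesis
    unfolding \<alpha> sum_1_5 by (simp add: e)
qed

end
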